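(* Fix $k\ge2$ and define $F^{(k)}_1=\cdots=F^{(k)}_k=1$ and $F^{(k)}_{i+1}=F^{(k)}_i+F^{(k)}_{i-1}+\cdots+F^{(k)}_{i-k+1}$ for $i\ge k$. Let $t$ be an indeterminate (or complex number) and let $v^{(k)}_2(n,t)$ be the sum of the squares of the coefficients of the polynomial $\prod_{i=1}^n\left(1+tx^{F^{(k)}_{i+k-1}}\right)$ in $x$. Then $$\sum_{n\ge0}v^{(k)}_2(n,t)x^n=\frac{1-t^{k-1}(1+t^2)x^k}{1-(1+t^2)x-t^{k-1}(1+t^2)x^k+t^{k-1}(1+t^4)x^{k+1}}.$$ *)

theory Defs
  imports "HOL-Computational_Algebra.Computational_Algebra"
begin

text \<open>The sequence starts at index 1; the value at index 0 is immaterial.\<close>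

function kfib :: "nat \<Rightarrow> nat \<Rightarrow> nat" where
  "kfib k i = (if i \<le> k then 1 else (\<Sum>j<k. kfib k (i - 1 - j)))"
  by pat_completeness auto
termination by (relation "measure snd") auto

declare kfib.simps [simp del]

lemma kfib_init: "1 \<le> i \<Longrightarrow> i \<le> k \<Longrightarrow> kfib k i = 1"
  by (simp add: kfib.simps)

lemma kfib_rec: "k \<le> i \<Longrightarrow> kfib k (i + 1) = (\<Sum>j<k. kfib k (i - j))"
  by (subst kfib.simps) simp

definition kfib_poly :: "nat \<Rightarrow> nat \<Rightarrow> 'a::comm_ring_1 \<Rightarrow> 'a poly" where
  "kfib_poly k n t = (\<Prod>i=1..n. 1 + monom t (kfib k (i + k - 1)))"

definition v2 :: "nat \<Rightarrow> nat \<Rightarrow> 'a::comm_ring_1 \<Rightarrow> 'a" where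
  "v2 k n t = (\<Sum>m\<le>degree (kfib_poly k n t). (coeff (kfib_poly k n t) m)\<^sup>2)"

end

theory Submission
  imports Defs
begin

text \<open>
  Let \<open>g\<^sub>0, g\<^sub>1, \<dots>\<close> be the exponents and \<open>S\<^sub>n\<close> the sum of the first \<open>n\<close> of them. The sum of squared
  coefficients is a weighted count of the sequences \<open>e \<in> {-1,0,1}\<^sup>n\<close> with \<open>\<Sum> e\<^sub>i g\<^sub>i = 0\<close>, where an
  entry \<open>0\<close> has weight \<open>1 + t\<^sup>2\<close> and an entry \<open>\<plusminus>1\<close> has weight \<open>t\<close>. Write \<open>A n m\<close> for the weighted
  count with \<open>\<Sum> e\<^sub>i g\<^sub>i = m\<close>, and put \<open>v n = A n 0\<close>, \<open>w n = A n g\<^sub>n\<close>. Splitting off the last entry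
  gives \<open>v (n+1) = (1 + t\<^sup>2) v n + 2 t w n\<close>. Since \<open>S\<^sub>n < g\<^sub>n\<^sub>+\<^sub>1\<close> and \<open>g\<^sub>n = S\<^sub>n - S\<^sub>n\<^sub>-\<^sub>k\<close>, in a
  representation of \<open>g\<^sub>n\<close> the last \<open>k - 1\<close> entries must all be \<open>1\<close>, which leaves a representation of
  \<open>g\<^sub>n\<^sub>-\<^sub>k\<close> by \<open>n - k + 1\<close> terms; hence
  \<open>w n = t\<^bsup>k-1\<^esup> ((1 + t\<^sup>2) w (n-k) + t v (n-k))\<close>. Eliminating \<open>w\<close> from the two linear equations of
  generating functions yields the claim.
\<close>

section \<open>Weighted signed sums\<close>

text \<open>The coefficient of \<open>x^m\<close> in the Laurent polynomial that is the product over
  \<open>i < n\<close> of \<open>(1 + t x^(g i)) (1 + t x^(- g i))\<close>.\<close>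

fun signed_sums :: "(nat \<Rightarrow> nat) \<Rightarrow> 'a::comm_ring_1 \<Rightarrow> nat \<Rightarrow> int \<Rightarrow> 'a" where
  "signed_sums g t 0 m = (if m = 0 then 1 else 0)"
| "signed_sums g t (Suc n) m = (1 + t\<^sup>2) * signed_sums g t n m
     + t * signed_sums g t n (m - int (g n)) + t * signed_sums g t n (m + int (g n))"

lemma signed_sums_uminus: "signed_sums g t n (- m) = signed_sums g t n m"
proof (induction n arbitrary: m)
  case (Suc n)
  have "signed_sums g t n (- m - int (g n)) = signed_sums g t n (m + int (g n))"
    using Suc.IH[of "m + int (g n)"] by (simp add: algebra_simps)
  moreover have "signed_sums g t n (- m + int (g n)) = signed_sums g t n (m - int (g n))"
    using Suc.IH[of "m - int (g n)"] by (simp add: algebra_simps)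
  ultimately show ?case
    using Suc.IH[of m] by (simp add: algebra_simps)
qed simp

lemma signed_sums_eq_0: "int (\<Sum>i<n. g i) < \<bar>m\<bar> \<Longrightarrow> signed_sums g t n m = 0"
proof (induction n arbitrary: m)
  case (Suc n)
  have "signed_sums g t n m = 0" "signed_sums g t n (m - int (g n)) = 0"
    "signed_sums g t n (m + int (g n)) = 0"
    using Suc.prems by (auto intro!: Suc.IH)
  then show ?case by simp
qed simp

lemma coeff_mult_one_plus_monom:
  fixes p :: "'a::comm_ring_1 poly"
  shows "coeff (p * (1 + monom t d)) j = coeff p j + (if d \<le> j then t * coeff p (j - d) else 0)"
  by (simp add: distrib_left mult.commute[of p] coeff_monom_mult)

lemma coeff_mult_monom_plus_const:
  fixes p :: "'a::comm_ring_1 poly"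
  shows "coeff (p * (monom 1 d + [:t:])) j = (if d \<le> j then coeff p (j - d) else 0) + t * coeff p j"
  by (simp add: distrib_left mult.commute[of p] coeff_monom_mult)

lemma coeff_prod_one_plus_monom_eq_0:
  fixes t :: "'a::comm_ring_1" and g :: "nat \<Rightarrow> nat"
  shows "(\<Sum>i<n. g i) < j \<Longrightarrow> coeff (\<Prod>i<n. 1 + monom t (g i)) j = 0"
  by (induction n arbitrary: j) (auto simp: coeff_mult_one_plus_monom)

text \<open>Since \<open>x^(g i) + t = x^(g i) (1 + t x^(- g i))\<close>, this product is the other
  one with its coefficients reversed about the total exponent.\<close>

lemma coeff_prod_monom_plus_const:
  fixes t :: "'a::comm_ring_1" and g :: "nat \<Rightarrow> nat"
  shows "coeff (\<Prod>i<n. monom 1 (g i) + [:t:]) j =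
    (if j \<le> (\<Sum>i<n. g i) then coeff (\<Prod>i<n. 1 + monom t (g i)) ((\<Sum>i<n. g i) - j) else 0)"
proof (induction n arbitrary: j)
  case (Suc n)
  have "(\<Sum>i<n. g i) + g n - j - g n = (\<Sum>i<n. g i) - j" by simp
  moreover have "(\<Sum>i<n. g i) - (j - g n) = (\<Sum>i<n. g i) + g n - j" if "g n \<le> j"
    using that by simp
  ultimately show ?case
    by (auto simp: coeff_mult_one_plus_monom coeff_mult_monom_plus_const Suc.IH
        coeff_prod_one_plus_monom_eq_0)
qed simp

text \<open>Multiplying the Laurent polynomial by \<open>x\<close> to the total exponent clears the
  negative powers and shifts \<open>m\<close> accordingly; the conditional covers indices that stay
  negative.\<close>

lemma coeff_prod_mult_reflected:
  fixes t :: "'a::comm_ring_1" and g :: "nat \<Rightarrow> nat"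
  shows "(if 0 \<le> int (\<Sum>i<n. g i) + m
      then coeff ((\<Prod>i<n. 1 + monom t (g i)) * (\<Prod>i<n. monom 1 (g i) + [:t:]))
             (nat (int (\<Sum>i<n. g i) + m))
      else 0) = signed_sums g t n m"
proof (induction n arbitrary: m)
  case 0
  show ?case by (auto simp: nat_eq_iff)
next
  case (Suc n)
  define R where "R = (\<Prod>i<n. 1 + monom t (g i)) * (\<Prod>i<n. monom 1 (g i) + [:t:])"
  define s where "s = (\<Sum>i<n. g i)"
  have IH: "signed_sums g t n m' = (if 0 \<le> int s + m' then coeff R (nat (int s + m')) else 0)" for m'
    unfolding R_def s_def by (rule Suc.IH[symmetric])
  have R': "(\<Prod>i<Suc n. 1 + monom t (g i)) * (\<Prod>i<Suc n. monom 1 (g i) + [:t:]) =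
      R * (1 + monom t (g n)) * (monom 1 (g n) + [:t:])"
    by (simp add: R_def mult_ac)
  have s': "(\<Sum>i<Suc n. g i) = s + g n"
    by (simp add: s_def)
  have neg: "signed_sums g t n m = 0" "signed_sums g t n (m - int (g n)) = 0"
    "signed_sums g t n (m + int (g n)) = 0" if "int (s + g n) + m < 0"
    using that by (auto intro!: signed_sums_eq_0 simp flip: s_def)
  show ?case
  proof (cases "0 \<le> int (s + g n) + m")
    case False
    then show ?thesis using neg unfolding s' by simp
  next
    case True
    define j where "j = nat (int (s + g n) + m)"
    have m: "m = int j - int s - int (g n)" using True by (simp add: j_def)
    have a1: "signed_sums g t n (m + int (g n)) = coeff R j"
      by (simp add: IH m)
    have a2: "signed_sums g t n m = (if g n \<le> j then coeff R (j - g n) else 0)"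
      by (auto simp: IH m nat_diff_distrib)
    have a3: "signed_sums g t n (m - int (g n)) =
        (if g n \<le> j \<and> g n \<le> j - g n then coeff R (j - g n - g n) else 0)"
    proof -
      have "nat (int j - 2 * int (g n)) = j - g n - g n" by simp
      then show ?thesis by (auto simp: IH m)
    qed
    have "coeff (R * (1 + monom t (g n)) * (monom 1 (g n) + [:t:])) j =
        signed_sums g t (Suc n) m"
      unfolding signed_sums.simps a1 a2 a3 coeff_mult_one_plus_monom coeff_mult_monom_plus_const
      by (simp add: algebra_simps power2_eq_square)
    with True show ?thesis unfolding R' s' j_def by simp
  qed
qed

lemma sum_squares_coeff_eq_signed_sums:
  fixes t :: "'a::comm_ring_1" and g :: "nat \<Rightarrow> nat"
  defines "P \<equiv> \<lambda>n. \<Prod>i<n. 1 + monom t (g i)"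
  shows "(\<Sum>j\<le>degree (P n). (coeff (P n) j)\<^sup>2) = signed_sums g t n 0"
proof -
  let ?s = "\<Sum>i<n. g i"
  have "degree (P n) \<le> ?s"
    unfolding P_def by (intro degree_le allI impI coeff_prod_one_plus_monom_eq_0)
  then have "(\<Sum>j\<le>degree (P n). (coeff (P n) j)\<^sup>2) = (\<Sum>j\<le>?s. (coeff (P n) j)\<^sup>2)"
    by (intro sum.mono_neutral_left) (auto simp: coeff_eq_0)
  \<comment> \<open>One factor of each square is moved to the mirror index \<open>?s - j\<close> of
    the reversed product, so that the sum becomes a convolution.\<close>
  also have "\<dots> = (\<Sum>j\<le>?s. coeff (P n) j * coeff (\<Prod>i<n. monom 1 (g i) + [:t:]) (?s - j))"
    by (intro sum.cong) (simp_all add: coeff_prod_monom_plus_const P_def power2_eq_square)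
  also have "\<dots> = coeff (P n * (\<Prod>i<n. monom 1 (g i) + [:t:])) ?s"
    by (simp add: coeff_mult)
  also have "\<dots> = signed_sums g t n 0"
    using coeff_prod_mult_reflected[of g n 0 t] by (simp add: P_def del: of_nat_sum)
  finally show ?thesis .
qed

section \<open>Sequences with a k-step recurrence\<close>

text \<open>\<open>recurrence\<close> makes \<open>g (n + k)\<close> the sum of the \<open>k\<close>
  preceding terms, written additively to avoid truncated subtraction.\<close>

locale k_step_sequence =
  fixes k :: nat and g :: "nat \<Rightarrow> nat"
  assumes k_ge_2: "2 \<le> k"
    and sum_less_initial: "n < k \<Longrightarrow> (\<Sum>i<n. g i) < g n"
    and recurrence: "g (n + k) + (\<Sum>i<n. g i) = (\<Sum>i<n + k. g i)"
begin

definition S :: "nat \<Rightarrow> nat" where "S n = (\<Sum>i<n. g i)"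

lemma S_Suc: "S (Suc n) = S n + g n"
  by (simp add: S_def)

lemma S_mono: "m \<le> n \<Longrightarrow> S m \<le> S n"
  unfolding S_def by (intro sum_mono2) auto

text \<open>For \<open>Suc n = q + k\<close> the recurrence gives
  \<open>g (Suc n) = S n + (g n - S q)\<close>. As \<open>k\<close> is at least 2,
  \<open>q < n\<close>, and the induction hypothesis at \<open>n - 1\<close> bounds
  \<open>S q\<close> below \<open>g n\<close>.\<close>

lemma S_less: "S n < g (Suc n)"
proof (induction n rule: less_induct)
  case (less n)
  show ?case
  proof (cases "Suc n < k")
    case True
    then show ?thesis using sum_less_initial[of "Suc n"] by (simp add: S_def)
  next
    case False
    then obtain q where q: "Suc n = q + k" by (metis add.commute le_Suc_ex not_less)
    have "n = Suc (n - 1)" "q \<le> n - 1" using q k_ge_2 by auto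
    then obtain p where p: "n = Suc p" "q \<le> p" by blast
    have "S q < g n" using S_mono[OF p(2)] less[of p] p by simp
    moreover have "g (Suc n) + S q = S n + g n"
      using recurrence[of q] by (simp add: S_def flip: q)
    ultimately show ?thesis by simp
  qed
qed

lemma S_less_double: "S n < 2 * g n"
proof (cases "n < k")
  case True
  then show ?thesis using sum_less_initial[of n] by (simp add: S_def)
next
  case False
  then obtain q where q: "n = q + k" by (metis add.commute le_Suc_ex not_less)
  have "n = Suc (n - 1)" "q \<le> n - 1" using q k_ge_2 by auto
  then obtain p where p: "n = Suc p" "q \<le> p" by blast
  have "S q < g n" using S_mono[OF p(2)] S_less[of p] p by simp
  then show ?thesis using recurrence[of q] by (simp add: S_def q)
qed

lemma signed_sums_out_of_range: "int (S n) < \<bar>m\<bar> \<Longrightarrow> signed_sums g t n m = 0"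
  unfolding S_def by (rule signed_sums_eq_0)

text \<open>Because \<open>S q < g p\<close>, a last entry 0 or -1 would leave a target above
  \<open>S p\<close>, out of reach for \<open>p\<close> terms.\<close>

lemma signed_sums_top_forced:
  assumes "q < p"
  shows "signed_sums g t (Suc p) (int (S (Suc p)) - int (S q)) =
    t * signed_sums g t p (int (S p) - int (S q))"
proof -
  from assms obtain r where r: "p = Suc r" "q \<le> r" by (cases p) auto
  have "S q < g p" using S_mono[OF r(2)] S_less[of r] r by simp
  then show ?thesis
    by (simp add: S_Suc signed_sums_out_of_range)
qed

text \<open>Forcing stops at \<open>Suc q\<close> terms, where the target is
  \<open>S (Suc q) - S q = g q\<close>.\<close>

lemma signed_sums_tops_forced:
  "signed_sums g t (Suc q + d) (int (S (Suc q + d)) - int (S q)) =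
    t ^ d * signed_sums g t (Suc q) (int (g q))"
proof (induction d)
  case 0
  show ?case by (simp add: S_Suc del: signed_sums.simps)
next
  case (Suc d)
  then show ?case
    using signed_sums_top_forced[of q "Suc q + d" t] by (simp del: signed_sums.simps)
qed

lemma signed_sums_0_Suc:
  "signed_sums g t (Suc n) 0 =
    (1 + t\<^sup>2) * signed_sums g t n 0 + 2 * t * signed_sums g t n (int (g n))"
  by (simp add: signed_sums_uminus)

lemma signed_sums_next_initial: "n < k \<Longrightarrow> signed_sums g t n (int (g n)) = 0"
  using sum_less_initial[of n] by (intro signed_sums_out_of_range) (simp add: S_def del: of_nat_sum)

lemma signed_sums_next_rec:
  "signed_sums g t (q + k) (int (g (q + k))) =
    t ^ (k - 1) * ((1 + t\<^sup>2) * signed_sums g t q (int (g q)) + t * signed_sums g t q 0)"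
proof -
  have k: "q + k = Suc q + (k - 1)" using k_ge_2 by simp
  have "int (g (q + k)) = int (S (q + k)) - int (S q)"
    using recurrence[of q] unfolding S_def by linarith
  then have "signed_sums g t (q + k) (int (g (q + k))) =
      t ^ (k - 1) * signed_sums g t (Suc q) (int (g q))"
    using signed_sums_tops_forced[of t q "k - 1"] unfolding k by simp
  \<comment> \<open>This excludes the entry -1 at position \<open>q\<close>; the entries 0 and 1
    give the two terms of the claim.\<close>
  moreover have "signed_sums g t q (2 * int (g q)) = 0"
    using S_less_double[of q] by (intro signed_sums_out_of_range) simp
  ultimately show ?thesis by simp
qed

theorem signed_sums_generating_function:
  fixes t :: "'a::field"
  shows "Abs_fps (\<lambda>n. signed_sums g t n 0) =
    (1 - fps_const (t ^ (k - 1) * (1 + t\<^sup>2)) * fps_X ^ k) /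
    (1 - fps_const (1 + t\<^sup>2) * fps_X
       - fps_const (t ^ (k - 1) * (1 + t\<^sup>2)) * fps_X ^ k
       + fps_const (t ^ (k - 1) * (1 + t ^ 4)) * fps_X ^ (k + 1))"
    (is "?V = ?N / ?D")
proof -
  define V where "V = ?V"
  define W where "W = Abs_fps (\<lambda>n. signed_sums g t n (int (g n)))"
  define \<tau> where "\<tau> = fps_const t"
  define T where "T = fps_const (t ^ (k - 1))"
  have c2: "fps_const (1 + t\<^sup>2) = 1 + \<tau>\<^sup>2"
    by (simp add: \<tau>_def fps_const_power flip: fps_const_add)
  have c4: "fps_const (1 + t ^ 4) = 1 + \<tau> ^ 4"
    by (simp add: \<tau>_def fps_const_power flip: fps_const_add)
  have Tc: "fps_const (t ^ (k - 1) * x) = T * fps_const x" for x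
    by (simp add: T_def)
  have V: "V = 1 + (1 + \<tau>\<^sup>2) * (fps_X * V) + 2 * \<tau> * (fps_X * W)"
  proof (rule fps_ext)
    fix n
    have "2 * \<tau> = fps_const (2 * t)"
      by (simp add: \<tau>_def numeral_fps_const)
    then show "V $ n = (1 + (1 + \<tau>\<^sup>2) * (fps_X * V) + 2 * \<tau> * (fps_X * W)) $ n"
      unfolding c2[symmetric]
      by (cases n) (simp_all add: V_def W_def signed_sums_0_Suc del: signed_sums.simps(2))
  qed
  have W: "W = T * ((1 + \<tau>\<^sup>2) * (fps_X ^ k * W) + \<tau> * (fps_X ^ k * V))"
  proof (rule fps_ext)
    fix n
    show "W $ n = (T * ((1 + \<tau>\<^sup>2) * (fps_X ^ k * W) + \<tau> * (fps_X ^ k * V))) $ n"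
    proof (cases "n < k")
      case True
      then show ?thesis
        unfolding c2[symmetric] unfolding T_def \<tau>_def
        by (simp add: W_def fps_X_power_mult_nth signed_sums_next_initial)
    next
      case False
      then obtain q where "n = q + k" by (metis add.commute le_Suc_ex not_less)
      then show ?thesis
        unfolding c2[symmetric] unfolding T_def \<tau>_def
        by (simp add: W_def V_def fps_X_power_mult_nth signed_sums_next_rec)
    qed
  qed
  have N: "?N = 1 - T * (1 + \<tau>\<^sup>2) * fps_X ^ k"
    unfolding Tc c2 by simp
  have D: "?D = 1 - (1 + \<tau>\<^sup>2) * fps_X - T * (1 + \<tau>\<^sup>2) * fps_X ^ k
      + T * (1 + \<tau> ^ 4) * (fps_X * fps_X ^ k)"
    unfolding Tc c2 c4 by simp
  \<comment> \<open>Stated for free variables so that \<open>algebra\<close> sees a polynomial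
    identity, with \<open>y\<close> for \<open>fps_X ^ k\<close>. The quartic arises as
    \<open>(1 + r^2)^2 - 2 r^2 = 1 + r^4\<close>.\<close>
  have elim: "v * (1 - (1 + r\<^sup>2) * x - c * (1 + r\<^sup>2) * y + c * (1 + r ^ 4) * (x * y)) =
      1 - c * (1 + r\<^sup>2) * y"
    if "v = 1 + (1 + r\<^sup>2) * (x * v) + 2 * r * (x * w)"
      and "w = c * ((1 + r\<^sup>2) * (y * w) + r * (y * v))" for v w c r x y :: "'a fps"
    using that by algebra
  have "V * ?D = ?N"
    unfolding N D by (rule elim[OF V W])
  moreover have "?D \<noteq> 0"
    using k_ge_2 by (intro fps_nonzeroI[of _ 0]) (simp add: fps_X_power_nth)
  ultimately show ?thesis
    unfolding V_def by (metis nonzero_mult_div_cancel_right)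
qed

end

section \<open>The k-Fibonacci numbers\<close>

lemma kfib_pos: "1 \<le> k \<Longrightarrow> 0 < kfib k i"
proof (induction i rule: less_induct)
  case (less i)
  show ?case
  proof (cases "i \<le> k")
    case True
    then show ?thesis by (simp add: kfib.simps)
  next
    case False
    with less.IH[of "i - 1 - 0"] less.prems have "0 < (\<Sum>j<k. kfib k (i - 1 - j))"
      by (intro sum_pos2[of _ 0]) auto
    with False show ?thesis by (subst kfib.simps) simp
  qed
qed

lemma kfib_eq_sum_shift: "1 \<le> n \<Longrightarrow> kfib k (n + k) = (\<Sum>i=n..<n + k. kfib k i)"
proof -
  assume "1 \<le> n"
  then have "kfib k (n + k) = (\<Sum>j<k. kfib k (n + k - 1 - j))"
    using kfib_rec[of k "n + k - 1"] by simp
  also have "\<dots> = (\<Sum>i=n..<n + k. kfib k i)"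
    by (rule sum.reindex_bij_witness[of _ "\<lambda>i. n + k - 1 - i" "\<lambda>j. n + k - 1 - j"]) auto
  finally show ?thesis .
qed

lemma sum_kfib_shift: "(\<Sum>i<n. kfib k (i + k)) = (\<Sum>i=k..<n + k. kfib k i)"
  using sum.shift_bounds_nat_ivl[of "kfib k" 0 k n] by (simp add: atLeast0LessThan)

lemma k_step_sequence_kfib:
  assumes "2 \<le> k"
  shows "k_step_sequence k (\<lambda>i. kfib k (i + k))"
proof
  show "2 \<le> k" by fact
next
  fix n assume "n < k"
  show "(\<Sum>i<n. kfib k (i + k)) < kfib k (n + k)"
  proof (cases "n = 0")
    case True
    then show ?thesis using assms kfib_pos[of k] by simp
  next
    case False
    \<comment> \<open>The right-hand window also contains the index \<open>n < k\<close>, whose term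
      is positive.\<close>
    have "(\<Sum>i=k..<n + k. kfib k i) < (\<Sum>i=n..<n + k. kfib k i)"
      using \<open>n < k\<close> assms kfib_pos[of k] by (intro sum_strict_mono2[of _ _ n]) (use False in auto)
    with False show ?thesis by (simp add: sum_kfib_shift kfib_eq_sum_shift)
  qed
next
  fix n
  \<comment> \<open>This window is exactly what the sum of the first \<open>n\<close> terms lacks to
    be the sum of the first \<open>n + k\<close>.\<close>
  have "kfib k (n + k + k) = (\<Sum>i=n + k..<n + k + k. kfib k i)"
    using assms by (intro kfib_eq_sum_shift) simp
  moreover have "(\<Sum>i=k..<n + k. kfib k i) + (\<Sum>i=n + k..<n + k + k. kfib k i) =
      (\<Sum>i=k..<n + k + k. kfib k i)"
    by (rule sum.atLeastLessThan_concat) auto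
  ultimately show "kfib k (n + k + k) + (\<Sum>i<n. kfib k (i + k)) = (\<Sum>i<n + k. kfib k (i + k))"
    unfolding sum_kfib_shift by simp
qed

lemma v2_eq_signed_sums: "v2 k n t = signed_sums (\<lambda>i. kfib k (i + k)) t n 0"
proof -
  have "kfib_poly k n t = (\<Prod>i<n. 1 + monom t (kfib k (i + k)))"
    unfolding kfib_poly_def
    by (rule prod.reindex_bij_witness[of _ Suc "\<lambda>i. i - 1"]) auto
  then show ?thesis
    unfolding v2_def by (simp add: sum_squares_coeff_eq_signed_sums)
qed

theorem theorem7:
  fixes k :: nat and t :: "'a::field"
  assumes "k \<ge> 2"
  shows "Abs_fps (\<lambda>n. v2 k n t) =
    (1 - fps_const (t ^ (k - 1) * (1 + t\<^sup>2)) * fps_X ^ k) /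
    (1 - fps_const (1 + t\<^sup>2) * fps_X
       - fps_const (t ^ (k - 1) * (1 + t\<^sup>2)) * fps_X ^ k
       + fps_const (t ^ (k - 1) * (1 + t ^ 4)) * fps_X ^ (k + 1))"
  unfolding v2_eq_signed_sums
  by (rule k_step_sequence.signed_sums_generating_function[OF k_step_sequence_kfib[OF assms]])

end
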